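(* Consider the parametric problem $\min_x f(x,\theta)$ subject to $g(x,\theta)\le 0$, with $f:\mathbb{R}^{n_x}\times\mathbb{R}^{n_\theta}\to\mathbb{R}$ quadratic, $g:\mathbb{R}^{n_x}\times\mathbb{R}^{n_\theta}\to\mathbb{R}^m$ affine, and $\theta\in\Theta_0\subseteq\mathbb{R}^{n_\theta}$. Let $\mathcal{P}$ be a program that realizes the dual active-set method described in the context, let $\{\Theta_i\}_{i=1}^N$ be the regions of the certification output for this method on $\Theta_0$, and let $\mathbb{W}_i$ denote the working-set sequence generated by all $\theta\in\Theta_i$. Assume that, given a particular processor state at the start of an iteration of $\mathcal{P}$, the working set $\mathcal{W}$ completely determines the sequence of executed processor instructions and the memory access pattern in that iteration. If $\mathbb{W}_j\prec\mathbb{W}_i$, then for every starting processor state $q$, $$\tau_{\mathcal{P}}(\theta_i,q)\ge\tau_{\mathcal{P}}(\theta_j,q)\quad\text{for all }\theta_i\in\Theta_i\text{ and }\theta_j\in\Theta_j.$$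
   Context: Programs and execution time. A program is a realization (code, compiler, hardware) of an algorithm that solves the given parametric problem for a given $\theta$. $\tau_{\mathcal{P}}(\theta,q)\in\mathbb{R}$ is the execution time of $\mathcal{P}$, started in processor state $q$, for solving the problem instance $\theta\in\Theta_0$. The program is never interrupted while running. Modeling conventions: a run is a succession of iterations of the underlying algorithm, with $q$ the processor state at the start of the first iteration. "Processor state" means the timing-relevant state (caches, pipeline, etc.), not the numerical values stored in memory or registers. The processor state at the start of the next iteration is determined by the processor state at the start of the current iteration together with the instructions executed and memory accesses made in it. The execution time is the total elapsed time of the run (a sum of nonnegative times spent in its iterations), the time spent in an iteration being determined by the processor state at its start and the instructions executed and memory accesses made in it. Dual active-set method. Given $\theta$, an initial dual iterate $\lambda_0$ and an initial working set $\mathcal{W}_0$ (a set of constraint indices enforced with equality), the method repeats iterations $k=0,1,\dots$ until termination. If $\mathcal{W}_k$ is not singular (its reduced Hessian is nonsingular), compute $\lambda^*$ by solving a linear system defined by $\mathcal{W}_k$. If $\lambda^*\ge 0$, compute $\mu$ as an affine transformation of $\lambda^*$ defined by $\mathcal{W}_k$; if $\mu\ge0$, return "optimum found", otherwise add a constraint to the working set and update $\lambda$. If $\lambda^*\not\ge0$, remove a constraint from the working set and update $\lambda$. If $\mathcal{W}_k$ is singular, compute $p$ by solving a linear system defined by $\mathcal{W}_k$; if $p\ge 0$, return "infeasible problem", otherwise remove a constraint from the working set and update $\lambda$. Certification output. A finite collection of tuples $\{(\bar k_i,\mathbb{W}_i,\Theta_i)\}_{i=1}^N$ such that, for each $i$,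 every $\theta\in\Theta_i$ makes the active-set method generate the same working-set sequence $\mathbb{W}_i=\{\mathcal{W}_k\}_{k=0}^{\bar k_i}$ (one working set per iteration), and the regions form a partition of $\Theta_0$ in the sense that $\bigcup_{i=1}^N\Theta_i=\Theta_0$ and $\mathring\Theta_i\cap\mathring\Theta_j=\emptyset$ for $i\ne j$ ($\mathring\Theta$ denotes the interior of $\Theta$). Subsequence relation. For working-set sequences, $\tilde{\mathbb{W}}\prec\mathbb{W}$ means that $|\mathbb{W}|>|\tilde{\mathbb{W}}|$ and the first $|\tilde{\mathbb{W}}|$ entries of $\mathbb{W}$ coincide, in order, with those of $\tilde{\mathbb{W}}$, where $|\cdot|$ is the length of a sequence. *)

theory Defs
  imports "HOL-Analysis.Analysis"
begin

record ('n::finite, 'p::finite, 'm::finite) qp =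
  Hess   :: "real^'n^'n"
  Cross  :: "real^'p^'n"
  Lin    :: "real^'n"
  HessP  :: "real^'p^'p"
  LinP   :: "real^'p"
  Const  :: real
  ConX   :: "real^'n^'m"
  ConP   :: "real^'p^'m"
  ConC   :: "real^'m"

definition qp_form ::
  "('n::finite, 'p::finite, 'm::finite) qp \<Rightarrow> (real^'n \<Rightarrow> real^'p \<Rightarrow> real) \<Rightarrow> (real^'n \<Rightarrow> real^'p \<Rightarrow> real^'m) \<Rightarrow> bool"
  where "qp_form D f g \<longleftrightarrow>
    transpose (Hess D) = Hess D \<and> transpose (HessP D) = HessP D \<and>
    (\<forall>x \<theta>. f x \<theta> = (1/2) * (x \<bullet> (Hess D *v x)) + x \<bullet> (Cross D *v \<theta>) + Lin D \<bullet> x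
                    + (1/2) * (\<theta> \<bullet> (HessP D *v \<theta>)) + LinP D \<bullet> \<theta> + Const D) \<and>
    (\<forall>x \<theta>. g x \<theta> = ConX D *v x + ConP D *v \<theta> + ConC D)"

text \<open>
  Write \<open>H = Hess D\<close>, \<open>A = ConX D\<close>. For positive definite \<open>H\<close>, the Lagrangian
  \<open>f x \<theta> + \<lambda> \<bullet> g x \<theta>\<close> is minimised over \<open>x\<close> at
  \<open>x = - H^{-1} (Cross D *v \<theta> + Lin D + A^T \<lambda>)\<close>. Up to a constant in \<open>\<lambda>\<close>, the dual problem is
  therefore to minimise \<open>(1/2) \<lambda>^T G \<lambda> + d^T \<lambda>\<close> over \<open>\<lambda> \<ge> 0\<close>, with \<open>G = dual_hess D\<close> and
  \<open>d = dual_lin D \<theta>\<close> below; moreover \<open>G \<lambda> + d = - g x \<theta>\<close> at that \<open>x\<close>, that is, the gradient of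
  the dual objective is the vector of primal slacks. If \<open>H\<close> is not invertible then
  \<open>matrix_inv H\<close> is an unspecified matrix, so the method below is meaningful as a dual method
  for invertible (in practice positive definite) \<open>H\<close>.
\<close>

definition dual_hess :: "('n::finite, 'p::finite, 'm::finite) qp \<Rightarrow> real^'m^'m"
  where "dual_hess D = ConX D ** matrix_inv (Hess D) ** transpose (ConX D)"

definition dual_lin :: "('n::finite, 'p::finite, 'm::finite) qp \<Rightarrow> real^'p \<Rightarrow> real^'m"
  where "dual_lin D \<theta> =
    ConX D *v (matrix_inv (Hess D) *v (Cross D *v \<theta> + Lin D)) - ConP D *v \<theta> - ConC D"

lemma dual_gradient_eq_slack:
  fixes D :: "('n::finite, 'p::finite, 'm::finite) qp"
  assumes "qp_form D f g"
    and "x = - (matrix_inv (Hess D) *v (Cross D *v \<theta> + Lin D + transpose (ConX D) *v l))"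
  shows "dual_hess D *v l + dual_lin D \<theta> = - g x \<theta>"
proof -
  define K where "K = matrix_inv (Hess D)"
  have g: "g x \<theta> = ConX D *v x + ConP D *v \<theta> + ConC D"
    using assms(1) by (simp add: qp_form_def)
  have "dual_hess D *v l = ConX D *v (K *v (transpose (ConX D) *v l))"
    by (simp only: dual_hess_def K_def matrix_vector_mul_assoc matrix_mul_assoc)
  moreover have "ConX D *v x = - (ConX D *v (K *v (Cross D *v \<theta> + Lin D))) -
      ConX D *v (K *v (transpose (ConX D) *v l))"
    unfolding assms(2) K_def[symmetric]
    by (simp only: vec.neg matrix_vector_right_distrib) simp
  ultimately show ?thesis
    unfolding g dual_lin_def K_def[symmetric] by (simp only:) simp
qed

text \<open>
  A working set is a set of constraint indices; a constraint in \<open>W\<close> is enforced with equality, and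
  the multiplier of a constraint outside \<open>W\<close> is fixed to zero. Vectors indexed by \<open>W\<close> are
  represented as vectors over all indices that vanish outside \<open>W\<close>. The reduced Hessian is the
  principal submatrix of \<open>dual_hess D\<close> with rows and columns in \<open>W\<close>.
\<close>

definition supported_on :: "'m::finite set \<Rightarrow> real^'m \<Rightarrow> bool"
  where "supported_on W v \<longleftrightarrow> (\<forall>i. i \<notin> W \<longrightarrow> v $ i = 0)"

definition red_null :: "('n::finite, 'p::finite, 'm::finite) qp \<Rightarrow> 'm set \<Rightarrow> real^'m \<Rightarrow> bool"
  where "red_null D W v \<longleftrightarrow> supported_on W v \<and> (\<forall>i\<in>W. (dual_hess D *v v) $ i = 0)"

definition singular_ws :: "('n::finite, 'p::finite, 'm::finite) qp \<Rightarrow> 'm set \<Rightarrow> bool"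
  where "singular_ws D W \<longleftrightarrow> (\<exists>v. v \<noteq> 0 \<and> red_null D W v)"

definition dual_sol :: "('n::finite, 'p::finite, 'm::finite) qp \<Rightarrow> real^'p \<Rightarrow> 'm set \<Rightarrow> real^'m"
  where "dual_sol D \<theta> W =
    (THE l. supported_on W l \<and> (\<forall>i\<in>W. (dual_hess D *v l + dual_lin D \<theta>) $ i = 0))"

lemma dual_sol_ex1:
  fixes D :: "('n::finite, 'p::finite, 'm::finite) qp"
  assumes "\<not> singular_ws D W"
  shows "\<exists>!l. supported_on W l \<and> (\<forall>i\<in>W. (dual_hess D *v l + dual_lin D \<theta>) $ i = 0)"
proof -
  define G where "G = dual_hess D"
  define r :: "real^'m \<Rightarrow> real^'m" where "r v = (\<chi> i. if i \<in> W then v $ i else 0)" for v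
  define T :: "real^'m \<Rightarrow> real^'m" where
    "T v = (\<chi> i. if i \<in> W then (G *v r v) $ i else v $ i)" for v
  have r_add: "r (u + v) = r u + r v" and r_scale: "r (c *\<^sub>R u) = c *\<^sub>R r u" for u v c
    by (simp_all add: r_def vec_eq_iff)
  have lin: "linear T"
    by (intro linearI)
      (simp_all add: T_def vec_eq_iff r_add r_scale matrix_vector_right_distrib matrix_vector_mult_scaleR)
  have r_supp: "r v = v" if "supported_on W v" for v
    using that by (auto simp: r_def supported_on_def vec_eq_iff)
  have null: "v = 0" if "supported_on W v" "\<forall>i\<in>W. (G *v v) $ i = 0" for v
    using assms that by (auto simp: singular_ws_def red_null_def G_def)
  have "inj T"
  proof (rule linear_injective_0[OF lin, THEN iffD2], intro allI impI)
    fix v assume v: "T v = 0"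
    then have 1: "supported_on W v"
      by (auto simp: supported_on_def T_def vec_eq_iff split: if_splits)
    have "\<forall>i\<in>W. (G *v r v) $ i = 0"
      using v by (auto simp: T_def vec_eq_iff split: if_splits)
    then show "v = 0" using null[OF 1] r_supp[OF 1] by simp
  qed
  then have "surj T" using linear_injective_imp_surjective[OF lin] by simp
  then obtain l where l: "T l = (\<chi> i. if i \<in> W then - (dual_lin D \<theta> $ i) else 0)"
    by (metis surjD)
  have supp: "supported_on W l"
    using l by (auto simp: supported_on_def T_def vec_eq_iff split: if_splits)
  have "\<forall>i\<in>W. (G *v r l) $ i = - (dual_lin D \<theta> $ i)"
    using l by (auto simp: T_def vec_eq_iff split: if_splits)
  then have sol: "\<forall>i\<in>W. (G *v l + dual_lin D \<theta>) $ i = 0"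
    using r_supp[OF supp] by simp
  show ?thesis
  proof (rule ex1I[of _ l])
    show "supported_on W l \<and> (\<forall>i\<in>W. (dual_hess D *v l + dual_lin D \<theta>) $ i = 0)"
      using supp sol by (simp add: G_def)
  next
    fix l' assume l': "supported_on W l' \<and> (\<forall>i\<in>W. (dual_hess D *v l' + dual_lin D \<theta>) $ i = 0)"
    have "l' - l = 0"
    proof (rule null)
      show "supported_on W (l' - l)" using l' supp by (simp add: supported_on_def)
      show "\<forall>i\<in>W. (G *v (l' - l)) $ i = 0"
        using l' sol by (simp add: G_def matrix_vector_mult_diff_distrib add_eq_0_iff)
    qed
    then show "l' = l" by simp
  qed
qed

definition slack :: "('n::finite, 'p::finite, 'm::finite) qp \<Rightarrow> real^'p \<Rightarrow> 'm set \<Rightarrow> real^'m \<Rightarrow> real^'m"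
  where "slack D \<theta> W l =
    (\<chi> i. if i \<in> W then 0 else (dual_hess D *v l + dual_lin D \<theta>) $ i)"

text \<open>
  The choices that are left open by the generic description of the method: which constraint is added
  or removed, how the dual iterate is updated, and which solution of the (singular) homogeneous
  system is taken as direction \<open>p\<close>. All of them may depend on the parameter, the current working
  set, the current dual iterate, and the vectors computed in the iteration, in that order.
\<close>

record ('p::finite, 'm::finite) das_rules =
  add_index :: "real^'p \<Rightarrow> 'm set \<Rightarrow> real^'m \<Rightarrow> real^'m \<Rightarrow> real^'m \<Rightarrow> 'm"
  add_dual  :: "real^'p \<Rightarrow> 'm set \<Rightarrow> real^'m \<Rightarrow> real^'m \<Rightarrow> real^'m \<Rightarrow> real^'m"
  rem_index :: "real^'p \<Rightarrow> 'm set \<Rightarrow> real^'m \<Rightarrow> real^'m \<Rightarrow> 'm"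
  rem_dual  :: "real^'p \<Rightarrow> 'm set \<Rightarrow> real^'m \<Rightarrow> real^'m \<Rightarrow> real^'m"
  sing_dir  :: "real^'p \<Rightarrow> 'm set \<Rightarrow> real^'m \<Rightarrow> real^'m"
  sing_rem_index :: "real^'p \<Rightarrow> 'm set \<Rightarrow> real^'m \<Rightarrow> real^'m \<Rightarrow> 'm"
  sing_rem_dual  :: "real^'p \<Rightarrow> 'm set \<Rightarrow> real^'m \<Rightarrow> real^'m \<Rightarrow> real^'m"

definition nonneg_vec :: "real^'m::finite \<Rightarrow> bool"
  where "nonneg_vec v \<longleftrightarrow> (\<forall>i. 0 \<le> v $ i)"

definition valid_rules ::
  "('n::finite, 'p::finite, 'm::finite) qp \<Rightarrow> (real^'p) set \<Rightarrow> ('p, 'm) das_rules \<Rightarrow> bool"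
  where "valid_rules D \<Theta>0 R \<longleftrightarrow> (\<forall>\<theta>\<in>\<Theta>0. \<forall>W l.
    (\<not> singular_ws D W \<longrightarrow>
      (let ls = dual_sol D \<theta> W; mu = slack D \<theta> W ls in
        (nonneg_vec ls \<longrightarrow> \<not> nonneg_vec mu \<longrightarrow> add_index R \<theta> W l ls mu \<notin> W) \<and>
        (\<not> nonneg_vec ls \<longrightarrow> rem_index R \<theta> W l ls \<in> W))) \<and>
    (singular_ws D W \<longrightarrow>
      (let p = sing_dir R \<theta> W l in
        p \<noteq> 0 \<and> red_null D W p \<and>
        (\<not> nonneg_vec p \<longrightarrow> sing_rem_index R \<theta> W l p \<in> W))))"

datatype 'm outcome = Optimum_Found | Infeasible_Problem | Continue "'m set" "real^'m"

definition das_iteration ::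
  "('n::finite, 'p::finite, 'm::finite) qp \<Rightarrow> ('p, 'm) das_rules \<Rightarrow> real^'p \<Rightarrow> 'm set \<Rightarrow> real^'m \<Rightarrow> 'm outcome"
  where "das_iteration D R \<theta> W l =
    (if \<not> singular_ws D W then
       (let ls = dual_sol D \<theta> W in
        if nonneg_vec ls then
          (let mu = slack D \<theta> W ls in
           if nonneg_vec mu then Optimum_Found
           else Continue (insert (add_index R \<theta> W l ls mu) W) (add_dual R \<theta> W l ls mu))
        else Continue (W - {rem_index R \<theta> W l ls}) (rem_dual R \<theta> W l ls))
     else
       (let p = sing_dir R \<theta> W l in
        if nonneg_vec p then Infeasible_Problem
        else Continue (W - {sing_rem_index R \<theta> W l p}) (sing_rem_dual R \<theta> W l p)))"

text \<open>
  \<open>generates D R \<theta> W l Ws\<close>: started with working set \<open>W\<close> and dual iterate \<open>l\<close>, the method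
  terminates, and \<open>Ws\<close> lists the working sets of its iterations, one per iteration.
\<close>

inductive generates ::
  "('n::finite, 'p::finite, 'm::finite) qp \<Rightarrow> ('p, 'm) das_rules \<Rightarrow> real^'p \<Rightarrow> 'm set \<Rightarrow> real^'m \<Rightarrow> 'm set list \<Rightarrow> bool"
  for D R \<theta> where
  gen_optimum: "das_iteration D R \<theta> W l = Optimum_Found \<Longrightarrow> generates D R \<theta> W l [W]"
| gen_infeasible: "das_iteration D R \<theta> W l = Infeasible_Problem \<Longrightarrow> generates D R \<theta> W l [W]"
| gen_continue: "das_iteration D R \<theta> W l = Continue W' l' \<Longrightarrow> generates D R \<theta> W' l' Ws \<Longrightarrow>
    generates D R \<theta> W l (W # Ws)"

definition certification ::
  "('n::finite, 'p::finite, 'm::finite) qp \<Rightarrow> ('p, 'm) das_rules \<Rightarrow> real^'m \<Rightarrow> 'm set \<Rightarrow> (real^'p) set \<Rightarrow>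
   nat \<Rightarrow> (nat \<Rightarrow> nat) \<Rightarrow> (nat \<Rightarrow> 'm set list) \<Rightarrow> (nat \<Rightarrow> (real^'p) set) \<Rightarrow> bool"
  where "certification D R l0 W0 \<Theta>0 N kbar WW \<Theta> \<longleftrightarrow>
    (\<forall>i\<in>{1..N}. length (WW i) = kbar i + 1 \<and> (\<forall>\<theta>\<in>\<Theta> i. generates D R \<theta> W0 l0 (WW i))) \<and>
    (\<Union>i\<in>{1..N}. \<Theta> i) = \<Theta>0 \<and>
    (\<forall>i\<in>{1..N}. \<forall>j\<in>{1..N}. i \<noteq> j \<longrightarrow> interior (\<Theta> i) \<inter> interior (\<Theta> j) = {})"

definition ws_prec :: "'m set list \<Rightarrow> 'm set list \<Rightarrow> bool"  (infix "\<prec>\<^sub>w" 50)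
  where "V \<prec>\<^sub>w W \<longleftrightarrow> length W > length V \<and> take (length V) W = V"

text \<open>
  Instructions (type \<open>'i\<close>) and memory accesses (type \<open>'a\<close>) are listed in order of occurrence.
\<close>

record ('m, 'i, 'a) iteration =
  wset   :: "'m set"
  instrs :: "'i list"
  accs   :: "'a list"

text \<open>
  A program: \<open>run P \<theta> q\<close> lists the iterations of the run on the parameter \<open>\<theta>\<close> started in processor
  state \<open>q\<close>. What is executed in an iteration may a priori depend on everything (in particular on
  \<open>\<theta>\<close> and on numerical data). The processor state at the start of the next iteration and the time
  spent in an iteration are functions of the processor state at the start of the current iteration
  and the instructions and memory accesses in it.
\<close>

record ('th, 'q, 'm, 'i, 'a) program =
  run        :: "'th \<Rightarrow> 'q \<Rightarrow> ('m, 'i, 'a) iteration list"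
  next_state :: "'q \<Rightarrow> 'i list \<Rightarrow> 'a list \<Rightarrow> 'q"
  iter_time  :: "'q \<Rightarrow> 'i list \<Rightarrow> 'a list \<Rightarrow> real"

definition nonneg_times :: "('th, 'q, 'm, 'i, 'a) program \<Rightarrow> bool"
  where "nonneg_times P \<longleftrightarrow> (\<forall>q is as. 0 \<le> iter_time P q is as)"

primrec state_at :: "('th, 'q, 'm, 'i, 'a) program \<Rightarrow> 'th \<Rightarrow> 'q \<Rightarrow> nat \<Rightarrow> 'q"
  where
  "state_at P \<theta> q 0 = q"
| "state_at P \<theta> q (Suc k) =
     next_state P (state_at P \<theta> q k) (instrs (run P \<theta> q ! k)) (accs (run P \<theta> q ! k))"

definition exec_time :: "('th, 'q, 'm, 'i, 'a) program \<Rightarrow> 'th \<Rightarrow> 'q \<Rightarrow> real"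
  where "exec_time P \<theta> q =
    (\<Sum>k<length (run P \<theta> q).
       iter_time P (state_at P \<theta> q k) (instrs (run P \<theta> q ! k)) (accs (run P \<theta> q ! k)))"

definition realizes ::
  "(real^'p, 'q, 'm, 'i, 'a) program \<Rightarrow> ('n::finite, 'p::finite, 'm::finite) qp \<Rightarrow> ('p, 'm) das_rules \<Rightarrow>
   real^'m \<Rightarrow> 'm set \<Rightarrow> (real^'p) set \<Rightarrow> bool"
  where "realizes P D R l0 W0 \<Theta>0 \<longleftrightarrow>
    (\<forall>\<theta>\<in>\<Theta>0. \<forall>q Ws. generates D R \<theta> W0 l0 Ws \<longrightarrow> map wset (run P \<theta> q) = Ws)"

text \<open>
  Given the processor state at the start of an iteration, the working set determines the executed
  instructions and the memory accesses: any two iterations (of possibly different runs, at possibly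
  different positions) that agree in the former two agree in the latter two.
\<close>

definition ws_determines_execution :: "('th, 'q, 'm, 'i, 'a) program \<Rightarrow> 'th set \<Rightarrow> bool"
  where "ws_determines_execution P \<Theta>0 \<longleftrightarrow>
    (\<forall>\<theta>\<in>\<Theta>0. \<forall>\<theta>'\<in>\<Theta>0. \<forall>q q' k k'.
       k < length (run P \<theta> q) \<longrightarrow> k' < length (run P \<theta>' q') \<longrightarrow>
       state_at P \<theta> q k = state_at P \<theta>' q' k' \<longrightarrow>
       wset (run P \<theta> q ! k) = wset (run P \<theta>' q' ! k') \<longrightarrow>
       instrs (run P \<theta> q ! k) = instrs (run P \<theta>' q' ! k') \<and>
       accs (run P \<theta> q ! k) = accs (run P \<theta>' q' ! k'))"

end

theory Submission
  imports Defs
begin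

text \<open>
  Along the common prefix of working sets, processor state and execution propagate identically in
  both runs, by induction on the iteration; the longer run then only adds nonnegative times.
\<close>

text \<open>The state at \<open>k\<close> depends only on iterations before \<open>k\<close>, so
  weak bounds suffice: \<open>k\<close> may equal the length of a run, giving the state after its
  last iteration.\<close>

lemma state_at_eq:
  assumes det: "ws_determines_execution P T" and "\<theta> \<in> T" "\<theta>' \<in> T"
    and "k \<le> length (run P \<theta> q)" "k \<le> length (run P \<theta>' q)"
    and "\<And>i. i < k \<Longrightarrow> wset (run P \<theta> q ! i) = wset (run P \<theta>' q ! i)"
  shows "state_at P \<theta> q k = state_at P \<theta>' q k"
  using assms(4-)
proof (induction k)
  case 0
  show ?case by simp
next
  case (Suc k)
  then have eq: "state_at P \<theta> q k = state_at P \<theta>' q k" by simp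
  \<comment> \<open>Determinism is used with both start states equal to \<open>q\<close> and both
    positions equal to \<open>k\<close>; the strict bounds come from those on
    \<open>Suc k\<close>.\<close>
  have "instrs (run P \<theta> q ! k) = instrs (run P \<theta>' q ! k) \<and> accs (run P \<theta> q ! k) = accs (run P \<theta>' q ! k)"
    using det[unfolded ws_determines_execution_def, rule_format, OF assms(2,3) _ _ eq] Suc.prems
    by simp
  with eq show ?case by simp
qed

text \<open>Phrased for runs alone, so that the active-set method enters only in the theorem,
  through \<open>certification\<close> and \<open>realizes\<close>.\<close>

lemma exec_time_mono:
  assumes det: "ws_determines_execution P T" and T: "\<theta> \<in> T" "\<theta>' \<in> T"
    and nonneg: "nonneg_times P"
    and len: "length (run P \<theta> q) \<le> length (run P \<theta>' q)"
    and wset: "\<And>k. k < length (run P \<theta> q) \<Longrightarrow> wset (run P \<theta> q ! k) = wset (run P \<theta>' q ! k)"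
  shows "exec_time P \<theta> q \<le> exec_time P \<theta>' q"
proof -
  let ?t = "\<lambda>\<theta> k. iter_time P (state_at P \<theta> q k) (instrs (run P \<theta> q ! k)) (accs (run P \<theta> q ! k))"
  have "?t \<theta> k = ?t \<theta>' k" if k: "k < length (run P \<theta> q)" for k
  proof -
    have eq: "state_at P \<theta> q k = state_at P \<theta>' q k"
      by (rule state_at_eq[OF det T]) (use k len wset in auto)
    show ?thesis
      using det[unfolded ws_determines_execution_def, rule_format, OF T _ _ eq wset] k len eq by simp
  qed
  \<comment> \<open>The summands now belong to \<open>\<theta>'\<close> but the range is still that
    of the run of \<open>\<theta>\<close>: a partial sum of
    \<open>exec_time P \<theta>' q\<close>.\<close>
  then have "exec_time P \<theta> q = (\<Sum>k<length (run P \<theta> q). ?t \<theta>' k)"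
    by (simp add: exec_time_def)
  also have "\<dots> \<le> exec_time P \<theta>' q"
    unfolding exec_time_def using len nonneg by (intro sum_mono2) (auto simp: nonneg_times_def)
  finally show ?thesis .
qed

theorem lemma2:
  fixes f :: "real^'nx \<Rightarrow> real^'nt \<Rightarrow> real"
    and g :: "real^'nx \<Rightarrow> real^'nt \<Rightarrow> real^'m"
    and D :: "('nx::finite, 'nt::finite, 'm::finite) qp"
    and R :: "('nt, 'm) das_rules"
    and \<Theta>0 :: "(real^'nt) set"
    and l0 :: "real^'m" and W0 :: "'m set"
    and P :: "(real^'nt, 'q, 'm, 'i, 'a) program"
    and N :: nat and kbar :: "nat \<Rightarrow> nat" and WW :: "nat \<Rightarrow> 'm set list"
    and \<Theta> :: "nat \<Rightarrow> (real^'nt) set" and i j :: nat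
  assumes "qp_form D f g"
    and "valid_rules D \<Theta>0 R"
    and "realizes P D R l0 W0 \<Theta>0"
    and "nonneg_times P"
    and "certification D R l0 W0 \<Theta>0 N kbar WW \<Theta>"
    and "ws_determines_execution P \<Theta>0"
    and "i \<in> {1..N}" and "j \<in> {1..N}"
    and "WW j \<prec>\<^sub>w WW i"
  shows "\<forall>q. \<forall>\<theta>i\<in>\<Theta> i. \<forall>\<theta>j\<in>\<Theta> j. exec_time P \<theta>i q \<ge> exec_time P \<theta>j q"
proof (intro allI ballI)
  fix q \<theta>i \<theta>j
  assume i: "\<theta>i \<in> \<Theta> i" and j: "\<theta>j \<in> \<Theta> j"
  have T: "\<theta>i \<in> \<Theta>0" "\<theta>j \<in> \<Theta>0"
    using assms(5,7,8) i j by (auto simp: certification_def)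
  have gen: "generates D R \<theta>i W0 l0 (WW i)" "generates D R \<theta>j W0 l0 (WW j)"
    using assms(5,7,8) i j by (auto simp: certification_def)
  \<comment> \<open>\<open>generates\<close> does not involve \<open>q\<close>, so the recorded
    working sets are the same for every start state.\<close>
  have run: "map wset (run P \<theta>i q) = WW i" "map wset (run P \<theta>j q) = WW j"
    using assms(3) T gen by (auto simp: realizes_def)
  have prec: "map wset (run P \<theta>j q) \<prec>\<^sub>w map wset (run P \<theta>i q)"
    using assms(9) by (simp add: run)
  show "exec_time P \<theta>j q \<le> exec_time P \<theta>i q"
  \<comment> \<open>The memberships are swapped because \<open>\<theta>j\<close> has the shorter
    run.\<close>
  proof (rule exec_time_mono[OF assms(6) T(2,1) assms(4)])
    show "length (run P \<theta>j q) \<le> length (run P \<theta>i q)"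
      using prec by (simp add: ws_prec_def)
    fix k assume k: "k < length (run P \<theta>j q)"
    have "map wset (run P \<theta>j q) ! k = take (length (run P \<theta>j q)) (map wset (run P \<theta>i q)) ! k"
      using prec by (simp add: ws_prec_def)
    then show "wset (run P \<theta>j q ! k) = wset (run P \<theta>i q ! k)"
      using k prec by (simp add: ws_prec_def)
  qed
qed

end
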